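(* Let $f:\mathbb{R}^n\to\mathbb{R}$ be convex and $L$-smooth with a minimizer $x^*$, $f^*=f(x^* )$, let $x^0\in\mathbb{R}^n$, $R=\|x^0-x^*\|_2$, $0<\varepsilon\le LR^2$, $0\le\tau\le\frac12$, and let $\widetilde\nabla f$ satisfy $\|\widetilde\nabla f(x)-\nabla f(x)\|_2\le\alpha\|\nabla f(x)\|_2$ for all $x$, where $$0<\alpha\le\frac19\left(\frac{\varepsilon}{2LR^2}\right)^{\tau}.$$ Then the algorithm RE-AGM combined with the regularization technique solves the problem with precision $\varepsilon$: there are a regularization parameter $\mu>0$ and input parameters $L'\ge\mu'>0$, $a\in[0,1/3]$, depending only on $L,R,\alpha,\tau,\varepsilon$, such that RE-AGM with parameters $(L',\mu',x^0,a)$ applied to $f_\mu(\cdot\,|\,x^0)$ with the gradient estimate $\widetilde\nabla f_\mu$ produces a point $x^N$ with $f(x^N)-f^*\le\varepsilon$ with complexity (number of iterations $N$ at most) $$72000\left(\frac{LR^2}{\varepsilon}\right)^{1-\tau}\ln\left(\frac{480LR^2}{\varepsilon}\right).$$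
   Context: $\|\cdot\|_2$ is the Euclidean norm; $f$ is differentiable. Convex: $f(x)+\langle\nabla f(x),y-x\rangle\le f(y)$ for all $x,y$. $L$-smooth: $f(y)\le f(x)+\langle\nabla f(x),y-x\rangle+\frac L2\|x-y\|_2^2$ for all $x,y$. Regularization technique: the method is applied to $f_\mu(x\,|\,x^0)=f(x)+\frac\mu2\|x-x^0\|_2^2$, with gradient estimate $\widetilde\nabla f_\mu(x)=\widetilde\nabla f(x)+\mu(x-x^0)$. Algorithm RE-AGM with parameters $(L',\mu',x^0,a)$ and a gradient estimate $\widetilde g:\mathbb{R}^n\to\mathbb{R}^n$ (here $\widetilde g=\widetilde\nabla f_\mu$): put $h=\frac1{4L'}\left(\frac{1-a}{1+a}\right)^{3/2}$, $\widehat L=8\frac{1+a}{(1-a)^3}L'$, $\gamma^*=\min\{\log_{\mu'/(2L')}(3a),\frac12\}$ (with $\log_{\mu'/(2L')}0=+\infty$), $s=\left(1+\frac14\left(\frac{\mu'}{2L'}\right)^{\gamma^*}\right)(1+a)^2+2a^2$, $m=\left(1-\frac14\left(\frac{\mu'}{2L'}\right)^{\gamma^*}\right)(1-a)^2-2a^2$, $q=\frac{\mu'}{2\widehat L}$, and let $\omega=\frac{(m-s)+\sqrt{(s-m)^2+4mq}}{2m}$ be the largest root of $m\omega^2+(s-m)\omega-q=0$. Set $u^0=x^0$ and for $k=0,1,2,\dots$ $$y^k=\frac{\omega u^k+x^k}{1+\omega},\qquad u^{k+1}=(1-\omega)u^k+\omega y^k-\frac{2\omega}{\mu'}\widetilde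 g(y^k),\qquad x^{k+1}=y^k-h\,\widetilde g(y^k).$$ *)

theory Defs
  imports Complex_Main "Jordan_Normal_Form.Matrix"
begin

text \<open>
  The parameters of the method must not depend on the dimension, so the dimension is a
  natural number \<open>n\<close> quantified inside the statement and \<open>\<real>\<^sup>n\<close> is \<open>carrier_vec n\<close>;
  a type such as \<open>real ^ 'n\<close> would fix the dimension before the parameters are chosen.
  Functions on \<open>\<real>\<^sup>n\<close> are constrained on \<open>carrier_vec n\<close> only.
\<close>

definition vnorm :: "real vec \<Rightarrow> real" where
  "vnorm v = sqrt (v \<bullet> v)"

text \<open>
  \<open>f\<close> is Frechet differentiable on \<open>\<real>\<^sup>n\<close> with gradient \<open>G\<close>. The epsilon-delta clause is that of
  \<open>has_derivative_within_alt\<close>, for the derivative \<open>v \<mapsto> \<langle>G x, v\<rangle>\<close>.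
\<close>

definition has_gradient :: "nat \<Rightarrow> (real vec \<Rightarrow> real) \<Rightarrow> (real vec \<Rightarrow> real vec) \<Rightarrow> bool" where
  "has_gradient n f G \<longleftrightarrow>
     (\<forall>x\<in>carrier_vec n. G x \<in> carrier_vec n \<and>
        (\<forall>e>0. \<exists>d>0. \<forall>y\<in>carrier_vec n. vnorm (y - x) < d \<longrightarrow>
           \<bar>f y - f x - G x \<bullet> (y - x)\<bar> \<le> e * vnorm (y - x)))"

definition convex_diff :: "nat \<Rightarrow> (real vec \<Rightarrow> real) \<Rightarrow> (real vec \<Rightarrow> real vec) \<Rightarrow> bool" where
  "convex_diff n f G \<longleftrightarrow>
     (\<forall>x\<in>carrier_vec n. \<forall>y\<in>carrier_vec n. f x + G x \<bullet> (y - x) \<le> f y)"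

definition L_smooth :: "nat \<Rightarrow> real \<Rightarrow> (real vec \<Rightarrow> real) \<Rightarrow> (real vec \<Rightarrow> real vec) \<Rightarrow> bool" where
  "L_smooth n L f G \<longleftrightarrow>
     (\<forall>x\<in>carrier_vec n. \<forall>y\<in>carrier_vec n.
        f y \<le> f x + G x \<bullet> (y - x) + L / 2 * (vnorm (x - y))\<^sup>2)"

definition minimizer :: "nat \<Rightarrow> (real vec \<Rightarrow> real) \<Rightarrow> real vec \<Rightarrow> bool" where
  "minimizer n f xs \<longleftrightarrow> xs \<in> carrier_vec n \<and> (\<forall>x\<in>carrier_vec n. f xs \<le> f x)"

definition relative_error ::
    "nat \<Rightarrow> real \<Rightarrow> (real vec \<Rightarrow> real vec) \<Rightarrow> (real vec \<Rightarrow> real vec) \<Rightarrow> bool" where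
  "relative_error n \<alpha> G g \<longleftrightarrow>
     (\<forall>x\<in>carrier_vec n. g x \<in> carrier_vec n \<and> vnorm (g x - G x) \<le> \<alpha> * vnorm (G x))"

text \<open>
  Gradient estimate of \<open>f\<^sub>\<mu>(x | x0) = f x + \<mu>/2 \<parallel>x - x0\<parallel>\<^sup>2\<close>, built from an estimate \<open>g\<close> of the
  gradient of \<open>f\<close>. The method accesses \<open>f\<^sub>\<mu>\<close> through this estimate only.
\<close>

definition reg_grad :: "real \<Rightarrow> real vec \<Rightarrow> (real vec \<Rightarrow> real vec) \<Rightarrow> real vec \<Rightarrow> real vec" where
  "reg_grad \<mu> x0 g x = g x + \<mu> \<cdot>\<^sub>v (x - x0)"

definition re_step :: "real \<Rightarrow> real \<Rightarrow> real" where
  "re_step L' a = 1 / (4 * L') * ((1 - a) / (1 + a)) powr (3 / 2)"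

definition re_Lhat :: "real \<Rightarrow> real \<Rightarrow> real" where
  "re_Lhat L' a = 8 * ((1 + a) / (1 - a) ^ 3) * L'"

text \<open>
  For \<open>a = 0\<close> the logarithm is \<open>+\<infinity>\<close> by convention, so the minimum is \<open>1/2\<close>; this has to be
  singled out because \<open>log b 0 = 0\<close> in HOL.
\<close>

definition re_gamma :: "real \<Rightarrow> real \<Rightarrow> real \<Rightarrow> real" where
  "re_gamma L' \<mu>' a = (if a = 0 then 1 / 2 else min (log (\<mu>' / (2 * L')) (3 * a)) (1 / 2))"

definition re_s :: "real \<Rightarrow> real \<Rightarrow> real \<Rightarrow> real" where
  "re_s L' \<mu>' a =
     (1 + 1 / 4 * (\<mu>' / (2 * L')) powr re_gamma L' \<mu>' a) * (1 + a)\<^sup>2 + 2 * a\<^sup>2"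

definition re_m :: "real \<Rightarrow> real \<Rightarrow> real \<Rightarrow> real" where
  "re_m L' \<mu>' a =
     (1 - 1 / 4 * (\<mu>' / (2 * L')) powr re_gamma L' \<mu>' a) * (1 - a)\<^sup>2 - 2 * a\<^sup>2"

definition re_q :: "real \<Rightarrow> real \<Rightarrow> real \<Rightarrow> real" where
  "re_q L' \<mu>' a = \<mu>' / (2 * re_Lhat L' a)"

definition re_omega :: "real \<Rightarrow> real \<Rightarrow> real \<Rightarrow> real" where
  "re_omega L' \<mu>' a =
     (let m = re_m L' \<mu>' a; s = re_s L' \<mu>' a; q = re_q L' \<mu>' a
      in ((m - s) + sqrt ((s - m)\<^sup>2 + 4 * m * q)) / (2 * m))"

text \<open>The state after \<open>k\<close> iterations is the pair \<open>(x\<^sup>k, u\<^sup>k)\<close>.\<close>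

primrec re_agm ::
    "real \<Rightarrow> real \<Rightarrow> real vec \<Rightarrow> real \<Rightarrow> (real vec \<Rightarrow> real vec) \<Rightarrow> nat \<Rightarrow> real vec \<times> real vec" where
  "re_agm L' \<mu>' x0 a g 0 = (x0, x0)"
| "re_agm L' \<mu>' x0 a g (Suc k) =
     (let (x, u) = re_agm L' \<mu>' x0 a g k;
          \<omega> = re_omega L' \<mu>' a;
          y = (1 / (1 + \<omega>)) \<cdot>\<^sub>v (\<omega> \<cdot>\<^sub>v u + x)
      in (y - re_step L' a \<cdot>\<^sub>v g y,
          (1 - \<omega>) \<cdot>\<^sub>v u + \<omega> \<cdot>\<^sub>v y - (2 * \<omega> / \<mu>') \<cdot>\<^sub>v g y))"

end

theory Submission
  imports Defs
begin

text \<open>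
  Take \<open>\<mu> = \<mu>' = \<epsilon> / (2 R\<^sup>2)\<close>, \<open>L' = L + \<mu>\<close>, \<open>a = \<theta> / 3\<close> with \<open>\<theta> = (\<epsilon> / (2 L R\<^sup>2))\<^sup>\<tau>\<close>, and let \<open>F\<close>
  be the regularized function. The error of the estimate is relative to the gradient of \<open>f\<close>, which
  does not vanish at the minimizer of \<open>F\<close>. If \<open>\<parallel>\<nabla>F(y)\<parallel> \<ge> \<mu> R\<close>, the estimate has relative error at most
  \<open>2 \<alpha> \<le> a\<close> as an estimate of \<open>\<nabla>F(y)\<close>; otherwise strong convexity shows that the gradient step from
  \<open>y\<close> already reaches the precision \<open>\<epsilon>\<close>. As long as the first case occurs, the Lyapunov function
  \<open>F(x) - F(xs) + \<mu>/4 \<parallel>u - xs\<parallel>\<^sup>2\<close>, centred at the minimizer of \<open>f\<close> and not of \<open>F\<close>, contracts by the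
  factor \<open>1 - \<omega>\<close>. Finally \<open>\<omega>\<close> is at least a constant times
  \<open>(\<mu> / L) / \<theta>\<close>, that is, a constant times \<open>(\<epsilon> / (L R\<^sup>2))\<close> to the power \<open>1 - \<tau>\<close>.
\<close>

section \<open>Scalar products in a fixed dimension\<close>

lemma scalar_prod_sum:
  fixes v w :: "real vec"
  assumes "v \<in> carrier_vec n" "w \<in> carrier_vec n"
  shows "v \<bullet> w = (\<Sum>i<n. v $ i * w $ i)"
  using assms by (auto simp: scalar_prod_def lessThan_atLeast0)

lemma scalar_prod_self_nonneg:
  fixes v :: "real vec"
  shows "0 \<le> v \<bullet> v"
  by (simp add: scalar_prod_def sum_nonneg)

lemma vnorm_power2: "(vnorm v)\<^sup>2 = v \<bullet> v"
  by (simp add: vnorm_def scalar_prod_self_nonneg)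

lemma scalar_prod_add_self:
  fixes v w :: "real vec"
  assumes "v \<in> carrier_vec n" "w \<in> carrier_vec n"
  shows "(v + c \<cdot>\<^sub>v w) \<bullet> (v + c \<cdot>\<^sub>v w) = v \<bullet> v + 2 * c * (v \<bullet> w) + c\<^sup>2 * (w \<bullet> w)"
proof -
  have "(\<Sum>i<n. (v $ i + c * w $ i) * (v $ i + c * w $ i)) =
      (\<Sum>i<n. v $ i * v $ i) + 2 * c * (\<Sum>i<n. v $ i * w $ i) + c\<^sup>2 * (\<Sum>i<n. w $ i * w $ i)"
    unfolding sum_distrib_left sum.distrib[symmetric]
    by (rule sum.cong) (auto simp: algebra_simps power2_eq_square)
  then show ?thesis
    using assms by (simp add: scalar_prod_sum[where n = n])
qed

text \<open>Expand the square of \<open>v + c \<cdot>\<^sub>v w\<close>, which is nonnegative, and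
  divide by \<open>2 * c\<close>.\<close>

lemma scalar_prod_young:
  fixes v w :: "real vec"
  assumes "v \<in> carrier_vec n" "w \<in> carrier_vec n" and "0 < c"
  shows "- (v \<bullet> w) \<le> v \<bullet> v / (2 * c) + c / 2 * (w \<bullet> w)"
proof -
  have "0 \<le> v \<bullet> v + 2 * c * (v \<bullet> w) + c\<^sup>2 * (w \<bullet> w)"
    using scalar_prod_add_self[OF assms(1,2), of c]
      scalar_prod_self_nonneg[of "v + c \<cdot>\<^sub>v w"] by simp
  then have "0 \<le> (v \<bullet> v + 2 * c * (v \<bullet> w) + c\<^sup>2 * (w \<bullet> w)) / (2 * c)"
    using assms(3) by simp
  then show ?thesis
    using assms(3) by (simp add: field_simps power2_eq_square)
qed

text \<open>Expanding the square of \<open>e - a v\<close> gives Cauchy-Schwarz in the form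
  \<open>v \<bullet> e \<le> a * (v \<bullet> v)\<close>, with no square roots.\<close>

lemma add_self_relative_error:
  fixes v e :: "real vec"
  assumes v: "v \<in> carrier_vec n" and e: "e \<in> carrier_vec n"
    and "0 < a" and ee: "e \<bullet> e \<le> a\<^sup>2 * (v \<bullet> v)"
  shows "(v + e) \<bullet> (v + e) \<le> (1 + a)\<^sup>2 * (v \<bullet> v)"
proof -
  have "0 \<le> (e + (- a) \<cdot>\<^sub>v v) \<bullet> (e + (- a) \<cdot>\<^sub>v v)"
    by (rule scalar_prod_self_nonneg)
  then have "2 * a * (v \<bullet> e) \<le> e \<bullet> e + a\<^sup>2 * (v \<bullet> v)"
    using scalar_prod_add_self[OF e v, of "- a"] comm_scalar_prod[OF e v] by simp
  then have "2 * a * (v \<bullet> e) \<le> 2 * a * (a * (v \<bullet> v))"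
    using ee by (simp add: power2_eq_square)
  then have "v \<bullet> e \<le> a * (v \<bullet> v)"
    using \<open>0 < a\<close> by simp
  then show ?thesis
    using scalar_prod_add_self[OF v e, of 1] ee e
    by (simp add: power2_eq_square algebra_simps)
qed

section \<open>One step of the method for a smooth, strongly convex function\<close>

text \<open>The condition \<open>h * M \<le> 1\<close> bounds the quadratic term by
  \<open>h / 2 * (g \<bullet> g)\<close>; completing the square then isolates the error
  \<open>g - d\<close> of the gradient estimate.\<close>

lemma gradient_step_descent:
  fixes y g d :: "real vec" and F :: "real vec \<Rightarrow> real"
  assumes y: "y \<in> carrier_vec n" and g: "g \<in> carrier_vec n" and d: "d \<in> carrier_vec n"
    and smooth: "\<And>x. x \<in> carrier_vec n \<Longrightarrow>
      F x \<le> F y + d \<bullet> (x - y) + M / 2 * ((x - y) \<bullet> (x - y))"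
    and "0 < h" "h * M \<le> 1"
  shows "F (y - h \<cdot>\<^sub>v g) \<le> F y + h / 2 * ((g - d) \<bullet> (g - d) - d \<bullet> d)"
proof -
  have diff: "y - h \<cdot>\<^sub>v g - y = (- h) \<cdot>\<^sub>v g"
    using y g by (intro eq_vecI) auto
  have "F (y - h \<cdot>\<^sub>v g) \<le> F y - h * (d \<bullet> g) + M / 2 * (h\<^sup>2 * (g \<bullet> g))"
    using smooth[of "y - h \<cdot>\<^sub>v g"] y g d unfolding diff by (simp add: power2_eq_square)
  also have "\<dots> \<le> F y - h * (d \<bullet> g) + h / 2 * (g \<bullet> g)"
  proof -
    have "(h * M) * (h / 2 * (g \<bullet> g)) \<le> 1 * (h / 2 * (g \<bullet> g))"
      using assms scalar_prod_self_nonneg[of g] by (intro mult_right_mono) auto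
    then show ?thesis by (simp add: power2_eq_square algebra_simps)
  qed
  also have "\<dots> = F y + h / 2 * ((g - d) \<bullet> (g - d) - d \<bullet> d)"
  proof -
    have "g + (- 1) \<cdot>\<^sub>v d = g - d"
      using g d by (intro eq_vecI) auto
    then have sq: "(g - d) \<bullet> (g - d) = g \<bullet> g - 2 * (d \<bullet> g) + d \<bullet> d"
      using scalar_prod_add_self[OF g d, of "- 1"] comm_scalar_prod[OF g d] by simp
    show ?thesis unfolding sq by (simp add: field_simps)
  qed
  finally show ?thesis .
qed

text \<open>
  Young's inequality splits the error terms \<open>\<langle>g - d, y - z\<rangle>\<close> and \<open>\<langle>g - d, u - y\<rangle>\<close>. The first square
  is absorbed by half of the strong convexity (modulus \<open>2 p\<close>, of which the Lyapunov function uses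
  \<open>p\<close>), the second one by the convexity defect of the squared norm in the averaging of \<open>u\<close> and \<open>y\<close>.
  The point \<open>z\<close> need not be a minimizer.
\<close>

lemma lyapunov_step:
  fixes x u y z g d :: "real vec" and F :: "real vec \<Rightarrow> real"
  assumes x: "x \<in> carrier_vec n" and u: "u \<in> carrier_vec n" and z: "z \<in> carrier_vec n"
    and g: "g \<in> carrier_vec n" and d: "d \<in> carrier_vec n"
    and y: "y = (1 / (1 + w)) \<cdot>\<^sub>v (w \<cdot>\<^sub>v u + x)"
    and u': "u' = (1 - w) \<cdot>\<^sub>v u + w \<cdot>\<^sub>v y - (w / p) \<cdot>\<^sub>v g"
    and sc: "F y + d \<bullet> (z - y) + p * ((z - y) \<bullet> (z - y)) \<le> F z"
    and conv: "F y + d \<bullet> (x - y) \<le> F x"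
    and desc: "F x' \<le> F y - h / 2 * (1 - a\<^sup>2) * (d \<bullet> d)"
    and err: "(g - d) \<bullet> (g - d) \<le> a\<^sup>2 * (d \<bullet> d)"
    and par: "w * a\<^sup>2 + w\<^sup>2 * (1 + a)\<^sup>2 / 2 \<le> p * h / 2 * (1 - a\<^sup>2)"
    and w: "0 \<le> w" "w \<le> 1" and p: "0 < p" and a: "0 < a"
  shows "F x' - F z + p / 2 * ((u' - z) \<bullet> (u' - z))
    \<le> (1 - w) * (F x - F z + p / 2 * ((u - z) \<bullet> (u - z)))"
proof -
  define A where "A = y - z"
  define B where "B = u - y"
  define e where "e = g - d"
  have yc: "y \<in> carrier_vec n" using x u y by simp
  have Ac: "A \<in> carrier_vec n" and Bc: "B \<in> carrier_vec n" and ec: "e \<in> carrier_vec n"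
    using yc z u g d by (auto simp: A_def B_def e_def)
  have geq: "g = d + e" unfolding e_def using g d by (intro eq_vecI) auto
  have zy: "z - y = (- 1) \<cdot>\<^sub>v A" unfolding A_def using z yc by (intro eq_vecI) auto
  have uz: "u - z = A + 1 \<cdot>\<^sub>v B" unfolding A_def B_def using z yc u by (intro eq_vecI) auto
  \<comment> \<open>This is the square of \<open>1 + w\<close> in expanded form, needed to clear the
    denominators coming from \<open>y\<close>.\<close>
  have "0 < 1 + (w * w + w * 2)" using w by (simp add: add_pos_nonneg)
  then have xy: "x - y = (- w) \<cdot>\<^sub>v B"
    unfolding B_def using x u yc w
    by (intro eq_vecI) (auto simp: y divide_simps algebra_simps)
  have u'z: "u' - z = (A + (1 - w) \<cdot>\<^sub>v B) + (- (w / p)) \<cdot>\<^sub>v g"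
    unfolding A_def B_def u' using u yc z g
    by (intro eq_vecI) (auto simp: algebra_simps)
  have "(u' - z) \<bullet> (u' - z) = (A + (1 - w) \<cdot>\<^sub>v B) \<bullet> (A + (1 - w) \<cdot>\<^sub>v B)
      - 2 * (w / p) * ((A + (1 - w) \<cdot>\<^sub>v B) \<bullet> g) + (w / p)\<^sup>2 * (g \<bullet> g)"
    unfolding u'z using Ac Bc g by (subst scalar_prod_add_self[where n = n]) auto
  moreover have "(A + (1 - w) \<cdot>\<^sub>v B) \<bullet> g
      = A \<bullet> d + A \<bullet> e + (1 - w) * (B \<bullet> d + B \<bullet> e)"
    unfolding geq using Ac Bc d ec
    by (simp add: add_scalar_prod_distrib[where n = n] scalar_prod_add_distrib[where n = n] distrib_left)
  ultimately have P1: "p / 2 * ((u' - z) \<bullet> (u' - z)) =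
      p / 2 * (A \<bullet> A + 2 * (1 - w) * (A \<bullet> B) + (1 - w)\<^sup>2 * (B \<bullet> B))
      - w * (A \<bullet> d + A \<bullet> e + (1 - w) * (B \<bullet> d + B \<bullet> e)) + w\<^sup>2 / (2 * p) * (g \<bullet> g)"
    using p scalar_prod_add_self[OF Ac Bc, of "1 - w"]
    by (simp add: field_simps power2_eq_square)
  have P2: "(u - z) \<bullet> (u - z) = A \<bullet> A + 2 * (A \<bullet> B) + B \<bullet> B"
    unfolding uz using scalar_prod_add_self[OF Ac Bc, of 1] by simp
  have c1: "F y - A \<bullet> d + p * (A \<bullet> A) \<le> F z"
    using sc d Ac comm_scalar_prod[OF d Ac] unfolding zy by simp
  have c2: "F y - w * (B \<bullet> d) \<le> F x"
    using conv d Bc comm_scalar_prod[OF d Bc] unfolding xy by simp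
  have y1: "- (A \<bullet> e) \<le> e \<bullet> e / (2 * p) + p / 2 * (A \<bullet> A)"
    using scalar_prod_young[OF ec Ac p] comm_scalar_prod[OF ec Ac] by simp
  have y2: "- (B \<bullet> e) \<le> e \<bullet> e / (2 * p) + p / 2 * (B \<bullet> B)"
    using scalar_prod_young[OF ec Bc p] comm_scalar_prod[OF ec Bc] by simp
  have gg: "g \<bullet> g \<le> (1 + a)\<^sup>2 * (d \<bullet> d)"
    unfolding geq using add_self_relative_error[OF d ec a] err by (simp add: e_def)
  \<comment> \<open>The common error term of both Young inequalities. Its weights \<open>w\<close>
    and \<open>w * (1 - w)\<close> add up to at most \<open>2 * w\<close>.\<close>
  define E where "E = e \<bullet> e / (2 * p)"
  have E: "0 \<le> E" using p by (simp add: E_def scalar_prod_self_nonneg)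
  have Ebd: "2 * w * E \<le> w * a\<^sup>2 * (d \<bullet> d) / p"
  proof -
    have "w / p * (e \<bullet> e) \<le> w / p * (a\<^sup>2 * (d \<bullet> d))"
      using err w p by (intro mult_left_mono) (auto simp: e_def)
    then show ?thesis using p by (simp add: E_def field_simps)
  qed
  have gbd: "w\<^sup>2 / (2 * p) * (g \<bullet> g) \<le> w\<^sup>2 / (2 * p) * ((1 + a)\<^sup>2 * (d \<bullet> d))"
    using gg p by (intro mult_left_mono) auto
  \<comment> \<open>This is \<open>par\<close> scaled by \<open>(d \<bullet> d) / p\<close>: the
    descent of the gradient step pays for the estimation error and for the square of
    \<open>g\<close> in the update of \<open>u\<close>.\<close>
  have tot: "w * a\<^sup>2 * (d \<bullet> d) / p + w\<^sup>2 / (2 * p) * ((1 + a)\<^sup>2 * (d \<bullet> d))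
      \<le> h / 2 * (1 - a\<^sup>2) * (d \<bullet> d)"
  proof -
    have "(w * a\<^sup>2 + w\<^sup>2 * (1 + a)\<^sup>2 / 2) * ((d \<bullet> d) / p)
        \<le> (p * h / 2 * (1 - a\<^sup>2)) * ((d \<bullet> d) / p)"
      using par p by (intro mult_right_mono) (auto simp: scalar_prod_self_nonneg)
    moreover have "(w * a\<^sup>2 + w\<^sup>2 * (1 + a)\<^sup>2 / 2) * ((d \<bullet> d) / p)
        = w * a\<^sup>2 * (d \<bullet> d) / p + w\<^sup>2 / (2 * p) * ((1 + a)\<^sup>2 * (d \<bullet> d))"
      using p by (simp add: field_simps)
    ultimately show ?thesis using p by simp
  qed
  define T where "T = w\<^sup>2 / (2 * p) * (g \<bullet> g)"
  have "F x' + 2 * w * E + T \<le> F y"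
    unfolding T_def using desc Ebd gbd tot by linarith
  moreover have "w * (F y - A \<bullet> d + p * (A \<bullet> A)) \<le> w * F z"
    using c1 w by (intro mult_left_mono)
  moreover have "(1 - w) * (F y - w * (B \<bullet> d)) \<le> (1 - w) * F x"
    using c2 w by (intro mult_left_mono) auto
  moreover have "w * - (A \<bullet> e) \<le> w * (E + p / 2 * (A \<bullet> A))"
    unfolding E_def using y1 w by (intro mult_left_mono)
  moreover have "(w * (1 - w)) * - (B \<bullet> e) \<le> (w * (1 - w)) * (E + p / 2 * (B \<bullet> B))"
    unfolding E_def using y2 w by (intro mult_left_mono) auto
  moreover have "w * (1 - w) * E \<le> w * E"
    using w E by (simp add: mult_left_le mult_right_mono)
  \<comment> \<open>The coefficients balance exactly. The products with \<open>d\<close> cancel;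
    \<open>A \<bullet> B\<close> has factor \<open>p * (1 - w)\<close> on both sides;
    \<open>A \<bullet> A\<close> gets p/2 - wp + wp/2 = (1-w)p/2; \<open>B \<bullet> B\<close> gets
    (1-w)^2 p/2 + w(1-w)p/2 = (1-w)p/2.\<close>
  ultimately show ?thesis
    unfolding P1 P2 T_def[symmetric]
    by (simp add: algebra_simps power2_eq_square add_divide_distrib diff_divide_distrib)
qed

section \<open>Size of the root \<open>re_omega\<close>\<close>

lemma quadratic_root:
  fixes m b q :: real
  assumes "0 < m" "0 \<le> b" "0 < q"
  defines "r \<equiv> (- b + sqrt (b\<^sup>2 + 4 * m * q)) / (2 * m)"
  shows "m * r\<^sup>2 + b * r = q" "0 < r"
proof -
  have "\<bar>b\<bar> < sqrt (b\<^sup>2 + 4 * m * q)"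
    using assms by (intro real_less_rsqrt) auto
  then show "0 < r"
    using assms by (simp add: r_def)
  have "2 * m * r + b = sqrt (b\<^sup>2 + 4 * m * q)"
    using assms by (simp add: r_def)
  then have "(2 * m * r + b)\<^sup>2 = b\<^sup>2 + 4 * m * q"
    using assms by simp
  then have "4 * m * (m * r\<^sup>2 + b * r) = 4 * m * q"
    by (simp add: power2_eq_square algebra_simps)
  then show "m * r\<^sup>2 + b * r = q"
    using assms by simp
qed

text \<open>
  Choosing \<open>3 a \<ge> sqrt (\<mu>' / (2 L'))\<close> makes the logarithm the smaller argument of the
  minimum in \<open>re_gamma\<close>.
\<close>

lemma powr_re_gamma:
  assumes "0 < \<mu>'" "\<mu>' \<le> L'" "0 < a" "\<mu>' / (2 * L') \<le> (3 * a)\<^sup>2"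
  shows "(\<mu>' / (2 * L')) powr re_gamma L' \<mu>' a = 3 * a"
proof -
  define k where "k = \<mu>' / (2 * L')"
  have k: "0 < k" "k < 1" "k \<le> (3 * a)\<^sup>2"
    using assms by (auto simp: k_def field_simps)
  have "ln k \<le> ln ((3 * a)\<^sup>2)"
    using k assms(3) by (subst ln_le_cancel_iff) auto
  also have "\<dots> = 2 * ln (3 * a)"
    using assms(3) ln_realpow[of "3 * a" 2] by simp
  finally have "ln (3 * a) / ln k \<le> 1 / 2"
    using k by (simp add: divide_simps)
  then have gamma: "re_gamma L' \<mu>' a = log k (3 * a)"
    using assms(3) by (simp add: re_gamma_def k_def log_def)
  have "k powr log k (3 * a) = 3 * a"
    using k assms(3) by (intro powr_log_cancel) auto
  then show ?thesis
    by (simp add: gamma flip: k_def)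
qed

text \<open>By \<open>powr_re_gamma\<close>, \<open>m\<close> and \<open>s\<close> become
  polynomials in \<open>a\<close>, and every bound is read off the equation m w^2 + (s - m) w = q.
  The third bound gives the rate of convergence; the fourth is the premise \<open>par\<close> of
  \<open>lyapunov_step\<close> for \<open>p = \<mu>' / 2\<close>.\<close>

lemma re_omega_bounds:
  assumes "0 < \<mu>'" "\<mu>' \<le> L'" "0 < a" "a \<le> 1 / 3" "\<mu>' / (2 * L') \<le> (3 * a)\<^sup>2"
  shows "0 < re_omega L' \<mu>' a" "re_omega L' \<mu>' a \<le> 1"
    and "\<mu>' / (2 * L') / (270 * a) \<le> re_omega L' \<mu>' a"
    and "re_omega L' \<mu>' a * a\<^sup>2 + (re_omega L' \<mu>' a)\<^sup>2 * (1 + a)\<^sup>2 / 2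
      \<le> \<mu>' / 2 * re_step L' a / 2 * (1 - a\<^sup>2)"
proof -
  define k where "k = \<mu>' / (2 * L')"
  define m where "m = re_m L' \<mu>' a"
  define s where "s = re_s L' \<mu>' a"
  define q where "q = re_q L' \<mu>' a"
  define w where "w = re_omega L' \<mu>' a"
  note a = assms(3,4)
  have k: "0 < k" "k \<le> 1 / 2" "k \<le> 9 * a\<^sup>2"
    using assms by (auto simp: k_def field_simps)
  have a2: "a\<^sup>2 \<le> 1 / 9" "a\<^sup>2 \<le> a / 3"
    using a mult_mono[of a "1/3" a "1/3"] mult_left_mono[of a "1/3" a]
    by (auto simp: power2_eq_square)
  have meq: "m = (1 - 3 / 4 * a) * (1 - a)\<^sup>2 - 2 * a\<^sup>2"
    and seq: "s = (1 + 3 / 4 * a) * (1 + a)\<^sup>2 + 2 * a\<^sup>2"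
    unfolding m_def s_def re_m_def re_s_def using powr_re_gamma[OF assms(1-3,5)] by simp_all
  have qeq: "q = k * ((1 - a) ^ 3 / (8 * (1 + a)))"
    using assms a by (simp add: q_def re_q_def re_Lhat_def k_def field_simps)
  have m0: "0 < m"
  proof -
    have "(2 / 3)\<^sup>2 \<le> (1 - a)\<^sup>2" using a by (intro power_mono) auto
    then have "3 / 4 * (4 / 9) \<le> (1 - 3 / 4 * a) * (1 - a)\<^sup>2"
      using a by (intro mult_mono) (auto simp: power2_eq_square)
    then show ?thesis unfolding meq using a2 by simp
  qed
  have m1: "m \<le> 1"
  proof -
    have "(1 - 3 / 4 * a) * (1 - a)\<^sup>2 \<le> 1 * 1"
      using a by (intro mult_mono power_le_one) auto
    then show ?thesis unfolding meq using zero_le_power2[of a] by linarith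
  qed
  have b: "s - m = 11 / 2 * a + 4 * a\<^sup>2 + 3 / 2 * (a * a\<^sup>2)"
    unfolding seq meq by (simp add: power2_eq_square field_simps)
  have aa2: "0 \<le> a * a\<^sup>2" "a * a\<^sup>2 \<le> a * (1 / 9)"
    using a a2 by (auto intro!: mult_left_mono)
  \<comment> \<open>For \<open>a \<le> 1 / 3\<close> the three terms of \<open>b\<close> are at most
    11/2 a, 4/3 a and 1/6 a, with sum 7 a.\<close>
  have b0: "0 \<le> s - m" and b1: "s - m \<le> 7 * a" and ba: "a\<^sup>2 \<le> s - m"
    using b a2 a aa2 zero_le_power2[of a] by linarith+
  have q0: "0 < q" unfolding qeq using k a by simp
  \<comment> \<open>The factor of \<open>k\<close> in \<open>qeq\<close> decreases in
    \<open>a\<close>; its value at a = 1/3 is 1/36.\<close>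
  have q1: "k / 36 \<le> q"
  proof -
    have "(2 / 3) ^ 3 \<le> (1 - a) ^ 3" using a by (intro power_mono) auto
    then have "(8 / 27) / (8 * (4 / 3)) \<le> (1 - a) ^ 3 / (8 * (1 + a))"
      using a by (intro frac_le) (auto simp: power3_eq_cube)
    then have "k * ((8 / 27) / (8 * (4 / 3))) \<le> k * ((1 - a) ^ 3 / (8 * (1 + a)))"
      using k by (intro mult_left_mono) auto
    then show ?thesis unfolding qeq by simp
  qed
  have q2: "q < 1"
  proof -
    have "(1 - a) ^ 3 \<le> 1" using a by (intro power_le_one) auto
    then have "(1 - a) ^ 3 / (8 * (1 + a)) \<le> 1 / 8" using a by (intro frac_le) auto
    then have "q \<le> 1 * (1 / 8)" unfolding qeq using k a by (intro mult_mono) auto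
    then show ?thesis by simp
  qed
  have weq: "w = (- (s - m) + sqrt ((s - m)\<^sup>2 + 4 * m * q)) / (2 * m)"
    by (simp add: w_def re_omega_def Let_def m_def s_def q_def)
  have root: "m * w\<^sup>2 + (s - m) * w = q" and w0: "0 < w"
    unfolding weq using quadratic_root[OF m0 b0 q0] by auto
  have s1: "1 \<le> s"
  proof -
    have "1 * 1 \<le> (1 + 3 / 4 * a) * (1 + a)\<^sup>2"
      using a by (intro mult_mono one_le_power) auto
    then show ?thesis unfolding seq using zero_le_power2[of a] by linarith
  qed
  \<comment> \<open>At 1 the quadratic already equals \<open>s\<close>, which exceeds
    \<open>q\<close>.\<close>
  have w1: "w \<le> 1"
  proof (rule ccontr)
    assume "\<not> w \<le> 1"
    then have "m * 1 + (s - m) * 1 \<le> m * w\<^sup>2 + (s - m) * w"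
      using m0 b0 by (intro add_mono mult_left_mono) auto
    then show False using root q2 s1 by simp
  qed
  show "0 < re_omega L' \<mu>' a" "re_omega L' \<mu>' a \<le> 1"
    using w0 w1 by (auto simp: w_def)
  \<comment> \<open>Otherwise the left side of the equation is below k/8100 + 7k/270 = 211k/8100,
    which is less than k/36 = 225k/8100. The quadratic term is small because
    \<open>k \<le> 9 * a\<^sup>2\<close>.\<close>
  have "k / (270 * a) \<le> w"
  proof (rule ccontr)
    define v where "v = k / (270 * a)"
    assume "\<not> k / (270 * a) \<le> w"
    then have wv: "w < v" by (simp add: v_def)
    have "m * w\<^sup>2 < m * v\<^sup>2"
      using m0 w0 wv by (intro mult_strict_left_mono power_strict_mono) auto
    moreover have "(s - m) * w \<le> 7 * a * v"
      using b0 b1 w0 wv a by (intro mult_mono) auto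
    moreover have "m * v\<^sup>2 \<le> 1 * (k / 8100)"
    proof (intro mult_mono m1)
      have "v\<^sup>2 = k / 72900 * (k / a\<^sup>2)"
        using a by (simp add: v_def power2_eq_square field_simps)
      also have "\<dots> \<le> k / 72900 * 9"
        using k a by (intro mult_left_mono) (auto simp: field_simps)
      finally show "v\<^sup>2 \<le> k / 8100" by simp
    qed (use m0 in auto)
    moreover have "7 * a * v = 7 / 270 * k" using a by (simp add: v_def)
    ultimately show False using root q1 k by linarith
  qed
  then show "\<mu>' / (2 * L') / (270 * a) \<le> re_omega L' \<mu>' a"
    by (simp add: k_def w_def)
  define t where "t = (1 - a) / (1 + a)"
  have t: "0 < t" "t \<le> 1" using a by (auto simp: t_def field_simps)
  \<comment> \<open>\<open>q\<close> carries the factor \<open>t\<^sup>2\<close> and the step size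
    carries \<open>t powr (3 / 2)\<close>; \<open>t \<le> 1\<close> puts them in the right
    order.\<close>
  have tp: "t\<^sup>2 \<le> t powr (3 / 2)"
    using t powr_mono'[of "3 / 2" 2 t] by (simp add: powr_numeral)
  \<comment> \<open>If \<open>m\<close> is too small for a comparison term by term,
    \<open>w\<^sup>2 \<le> w\<close> moves the excess of the quadratic coefficient to the linear
    one, where \<open>s\<close> has room for it.\<close>
  have "w * a\<^sup>2 + w\<^sup>2 * (1 + a)\<^sup>2 / 2 \<le> m * w\<^sup>2 + (s - m) * w"
  proof (cases "(1 + a)\<^sup>2 / 2 \<le> m")
    case True
    then have "w\<^sup>2 * ((1 + a)\<^sup>2 / 2) \<le> w\<^sup>2 * m" by (intro mult_left_mono) auto
    moreover have "w * a\<^sup>2 \<le> w * (s - m)" using ba w0 by (intro mult_left_mono) auto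
    ultimately show ?thesis by (simp add: algebra_simps)
  next
    case False
    have "w\<^sup>2 * ((1 + a)\<^sup>2 / 2 - m) \<le> w * ((1 + a)\<^sup>2 / 2 - m)"
      using False w0 w1 by (intro mult_right_mono) (auto simp: power2_eq_square mult_left_le)
    also have "\<dots> \<le> w * (s - m - a\<^sup>2)"
    proof -
      have "1 * (1 + a)\<^sup>2 \<le> (1 + 3 / 4 * a) * (1 + a)\<^sup>2"
        using a by (intro mult_right_mono) auto
      then have "(1 + a)\<^sup>2 / 2 \<le> s - a\<^sup>2"
        unfolding seq using zero_le_power2[of a] zero_le_power2[of "1 + a"] by linarith
      then show ?thesis using w0 by (intro mult_left_mono) auto
    qed
    finally show ?thesis by (simp add: algebra_simps)
  qed
  also have "\<dots> = k / 8 * ((1 - a\<^sup>2) * t\<^sup>2)"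
  proof -
    have eq: "(1 - a) ^ 3 / (8 * (1 + a)) = (1 - a\<^sup>2) * t\<^sup>2 / 8"
    proof -
      have "1 - a\<^sup>2 = (1 - a) * (1 + a)" by (simp add: power2_eq_square algebra_simps)
      then show ?thesis using a by (simp add: t_def power2_eq_square power3_eq_cube divide_simps)
    qed
    show ?thesis unfolding root qeq eq by simp
  qed
  also have "\<dots> \<le> k / 8 * ((1 - a\<^sup>2) * t powr (3 / 2))"
    using tp k a2 by (intro mult_left_mono) auto
  also have "\<dots> = \<mu>' / 2 * re_step L' a / 2 * (1 - a\<^sup>2)"
    using assms by (simp add: k_def re_step_def t_def)
  finally show "re_omega L' \<mu>' a * a\<^sup>2 + (re_omega L' \<mu>' a)\<^sup>2 * (1 + a)\<^sup>2 / 2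
      \<le> \<mu>' / 2 * re_step L' a / 2 * (1 - a\<^sup>2)"
    by (simp add: w_def)
qed

section \<open>The regularized function\<close>

definition reg_fun :: "(real vec \<Rightarrow> real) \<Rightarrow> real \<Rightarrow> real vec \<Rightarrow> real vec \<Rightarrow> real" where
  "reg_fun f \<mu> x0 x = f x + \<mu> / 2 * ((x - x0) \<bullet> (x - x0))"

text \<open>The penalty is quadratic, so it equals its second-order expansion. Strong convexity and
  smoothness of the regularized function thus follow from convexity and smoothness of
  \<open>f\<close>.\<close>

lemma reg_fun_expand:
  fixes x y x0 :: "real vec"
  assumes x: "x \<in> carrier_vec n" and y: "y \<in> carrier_vec n" and x0: "x0 \<in> carrier_vec n"
    and G: "G y \<in> carrier_vec n"
  shows "reg_fun f \<mu> x0 x - reg_fun f \<mu> x0 y - reg_grad \<mu> x0 G y \<bullet> (x - y)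
    = f x - f y - G y \<bullet> (x - y) + \<mu> / 2 * ((x - y) \<bullet> (x - y))"
proof -
  have "x - x0 = (y - x0) + 1 \<cdot>\<^sub>v (x - y)"
    using x y x0 by (intro eq_vecI) auto
  then have "(x - x0) \<bullet> (x - x0)
      = (y - x0) \<bullet> (y - x0) + 2 * ((y - x0) \<bullet> (x - y)) + (x - y) \<bullet> (x - y)"
    using scalar_prod_add_self[of "y - x0" n "x - y" 1] x y x0 by simp
  moreover have "reg_grad \<mu> x0 G y \<bullet> (x - y) = G y \<bullet> (x - y) + \<mu> * ((y - x0) \<bullet> (x - y))"
    unfolding reg_grad_def using x y x0 G by (simp add: add_scalar_prod_distrib[where n = n])
  ultimately show ?thesis
    by (simp add: reg_fun_def field_simps)
qed

lemma re_step_bounds: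
  assumes "0 < L'" "0 \<le> a" "a < 1"
  shows "0 < re_step L' a" "re_step L' a * L' \<le> 1 / 4"
proof -
  have r: "0 < (1 - a) / (1 + a)" "(1 - a) / (1 + a) \<le> 1"
    using assms by auto
  show "0 < re_step L' a"
    using r assms by (simp add: re_step_def)
  have "((1 - a) / (1 + a)) powr (3 / 2) \<le> 1"
    using r by (intro powr_le1) (auto simp del: abs_divide)
  then show "re_step L' a * L' \<le> 1 / 4"
    using assms by (simp add: re_step_def)
qed

section \<open>Analysis of the method on the regularized problem\<close>

text \<open>The method runs with \<open>L' = L + \<mu>\<close> and \<open>\<mu>' = \<mu>\<close>.
  The bound \<open>3 * \<alpha> \<le> a\<close> leaves room for the factor 2 lost in passing from
  the gradient of \<open>f\<close> to that of \<open>F\<close>; \<open>cond_bound\<close> makes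
  \<open>powr_re_gamma\<close> applicable.\<close>

locale regularized_problem =
  fixes n :: nat and f :: "real vec \<Rightarrow> real" and G g :: "real vec \<Rightarrow> real vec"
    and x0 xs :: "real vec" and L \<mu> \<alpha> a :: real
  assumes G_carrier: "x \<in> carrier_vec n \<Longrightarrow> G x \<in> carrier_vec n"
    and convex: "convex_diff n f G"
    and smooth: "L_smooth n L f G"
    and minimizer: "minimizer n f xs"
    and x0_carrier: "x0 \<in> carrier_vec n"
    and error: "relative_error n \<alpha> G g"
    and L_pos: "0 < L" and \<mu>_pos: "0 < \<mu>" and \<alpha>_pos: "0 < \<alpha>"
    and a_bound: "3 * \<alpha> \<le> a" "a \<le> 1 / 3"
    and cond_bound: "\<mu> / (2 * (L + \<mu>)) \<le> (3 * a)\<^sup>2"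
begin

abbreviation "F \<equiv> reg_fun f \<mu> x0"
abbreviation "dF \<equiv> reg_grad \<mu> x0 G"
abbreviation "gF \<equiv> reg_grad \<mu> x0 g"
abbreviation "h \<equiv> re_step (L + \<mu>) a"
abbreviation "\<omega> \<equiv> re_omega (L + \<mu>) \<mu> a"
abbreviation "R2 \<equiv> (x0 - xs) \<bullet> (x0 - xs)"
abbreviation "X k \<equiv> fst (re_agm (L + \<mu>) \<mu> x0 a gF k)"
abbreviation "U k \<equiv> snd (re_agm (L + \<mu>) \<mu> x0 a gF k)"
abbreviation "Y k \<equiv> (1 / (1 + \<omega>)) \<cdot>\<^sub>v (\<omega> \<cdot>\<^sub>v U k + X k)"

lemma xs_carrier: "xs \<in> carrier_vec n"
  and xs_min: "x \<in> carrier_vec n \<Longrightarrow> f xs \<le> f x"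
  using minimizer by (auto simp: minimizer_def)

lemma g_carrier: "x \<in> carrier_vec n \<Longrightarrow> g x \<in> carrier_vec n"
  using error by (auto simp: relative_error_def)

lemma a_pos: "0 < a"
  using a_bound \<alpha>_pos by simp

lemma dF_carrier: "x \<in> carrier_vec n \<Longrightarrow> dF x \<in> carrier_vec n"
  and gF_carrier: "x \<in> carrier_vec n \<Longrightarrow> gF x \<in> carrier_vec n"
  using G_carrier g_carrier x0_carrier by (auto simp: reg_grad_def)

lemma h_pos: "0 < h" and h_le: "h * (L + \<mu>) \<le> 1 / 4"
  using re_step_bounds[of "L + \<mu>" a] L_pos \<mu>_pos a_pos a_bound by auto

lemma F_xs: "F xs = f xs + \<mu> / 2 * R2"
proof -
  have "xs - x0 = (- 1) \<cdot>\<^sub>v (x0 - xs)"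
    using xs_carrier x0_carrier by (intro eq_vecI) auto
  then show ?thesis
    using xs_carrier x0_carrier by (simp add: reg_fun_def)
qed

lemma f_le_F: "f x \<le> F x"
  using \<mu>_pos scalar_prod_self_nonneg[of "x - x0"] by (simp add: reg_fun_def)

lemma F_strongly_convex:
  assumes "x \<in> carrier_vec n" "y \<in> carrier_vec n"
  shows "F y + dF y \<bullet> (x - y) + \<mu> / 2 * ((x - y) \<bullet> (x - y)) \<le> F x"
  using reg_fun_expand[where G = G and f = f and \<mu> = \<mu>, OF assms x0_carrier G_carrier[OF assms(2)]]
    convex assms by (fastforce simp: convex_diff_def)

lemma F_smooth:
  assumes "x \<in> carrier_vec n" "y \<in> carrier_vec n"
  shows "F x \<le> F y + dF y \<bullet> (x - y) + (L + \<mu>) / 2 * ((x - y) \<bullet> (x - y))"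
proof -
  have "y - x = (- 1) \<cdot>\<^sub>v (x - y)" using assms by (intro eq_vecI) auto
  then have "(vnorm (y - x))\<^sup>2 = (x - y) \<bullet> (x - y)"
    using assms by (simp add: vnorm_power2)
  then have "f x \<le> f y + G y \<bullet> (x - y) + L / 2 * ((x - y) \<bullet> (x - y))"
    using smooth assms unfolding L_smooth_def by metis
  then show ?thesis
    using reg_fun_expand[where G = G and f = f and \<mu> = \<mu>, OF assms x0_carrier G_carrier[OF assms(2)]]
    by (simp add: add_divide_distrib distrib_right)
qed

lemma F_descent:
  assumes "y \<in> carrier_vec n"
  shows "F (y - h \<cdot>\<^sub>v gF y) \<le> F y + h / 2 * ((gF y - dF y) \<bullet> (gF y - dF y) - dF y \<bullet> dF y)"
  using assms h_pos h_le F_smooth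
  by (intro gradient_step_descent[where n = n and M = "L + \<mu>"]) (auto intro: dF_carrier gF_carrier)

text \<open>
  As \<open>\<langle>G y, y - xs\<rangle> \<ge> 0\<close>, the norm of \<open>G y\<close> is at most that of
  \<open>G y + \<mu> (y - xs) = dF y + \<mu> (x0 - xs)\<close>.
\<close>

lemma grad_bound:
  assumes y: "y \<in> carrier_vec n"
  shows "G y \<bullet> G y \<le> 2 * (dF y \<bullet> dF y) + 2 * \<mu>\<^sup>2 * R2"
proof -
  have r: "x0 - xs \<in> carrier_vec n" and D: "y - xs \<in> carrier_vec n"
    using x0_carrier xs_carrier y by auto
  note d = dF_carrier[OF y] and Gy = G_carrier[OF y]
  have "G y \<bullet> (xs - y) \<le> 0"
    using convex y xs_carrier xs_min[OF y] unfolding convex_diff_def by fastforce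
  moreover have "xs - y = (- 1) \<cdot>\<^sub>v (y - xs)"
    using y xs_carrier by (intro eq_vecI) auto
  ultimately have "0 \<le> G y \<bullet> (y - xs)"
    using Gy D by simp
  then have "G y \<bullet> G y \<le> (G y + \<mu> \<cdot>\<^sub>v (y - xs)) \<bullet> (G y + \<mu> \<cdot>\<^sub>v (y - xs))"
    using scalar_prod_add_self[OF Gy D, of \<mu>] scalar_prod_self_nonneg[of "y - xs"] \<mu>_pos by simp
  also have "G y + \<mu> \<cdot>\<^sub>v (y - xs) = dF y + \<mu> \<cdot>\<^sub>v (x0 - xs)"
    using y xs_carrier x0_carrier Gy
    by (intro eq_vecI) (auto simp: reg_grad_def algebra_simps)
  also have "\<dots> \<bullet> \<dots> \<le> 2 * (dF y \<bullet> dF y) + 2 * \<mu>\<^sup>2 * R2"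
    using scalar_prod_add_self[OF d r, of \<mu>] scalar_prod_add_self[OF d r, of "- \<mu>"]
      scalar_prod_self_nonneg[of "dF y + (- \<mu>) \<cdot>\<^sub>v (x0 - xs)"] by simp
  finally show ?thesis .
qed

text \<open>The gradient of the penalty is known exactly, so the error is that of \<open>g\<close>
  as an estimate of \<open>G\<close>, and \<open>grad_bound\<close> applies.\<close>

lemma estimate_error:
  assumes y: "y \<in> carrier_vec n"
  shows "(gF y - dF y) \<bullet> (gF y - dF y) \<le> \<alpha>\<^sup>2 * (2 * (dF y \<bullet> dF y) + 2 * \<mu>\<^sup>2 * R2)"
proof -
  have "gF y - dF y = g y - G y"
    using y G_carrier[OF y] g_carrier[OF y] x0_carrier
    by (intro eq_vecI) (auto simp: reg_grad_def)
  moreover have "(vnorm (g y - G y))\<^sup>2 \<le> (\<alpha> * vnorm (G y))\<^sup>2"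
    using error y by (intro power_mono) (auto simp: relative_error_def vnorm_def scalar_prod_self_nonneg)
  ultimately have "(gF y - dF y) \<bullet> (gF y - dF y) \<le> \<alpha>\<^sup>2 * (G y \<bullet> G y)"
    by (simp add: vnorm_power2 power_mult_distrib)
  also have "\<dots> \<le> \<alpha>\<^sup>2 * (2 * (dF y \<bullet> dF y) + 2 * \<mu>\<^sup>2 * R2)"
    using grad_bound[OF y] by (intro mult_left_mono) auto
  finally show ?thesis .
qed

lemma large_gradient_error:
  assumes y: "y \<in> carrier_vec n" and "\<mu>\<^sup>2 * R2 \<le> dF y \<bullet> dF y"
  shows "(gF y - dF y) \<bullet> (gF y - dF y) \<le> a\<^sup>2 * (dF y \<bullet> dF y)"
proof -
  have "(gF y - dF y) \<bullet> (gF y - dF y) \<le> \<alpha>\<^sup>2 * (4 * (dF y \<bullet> dF y))"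
    using assms(2) by (intro order_trans[OF estimate_error[OF y]] mult_left_mono) auto
  also have "\<dots> = (2 * \<alpha>)\<^sup>2 * (dF y \<bullet> dF y)"
    by (simp add: power_mult_distrib)
  also have "\<dots> \<le> a\<^sup>2 * (dF y \<bullet> dF y)"
    using a_bound \<alpha>_pos by (intro mult_right_mono power_mono scalar_prod_self_nonneg) auto
  finally show ?thesis .
qed

text \<open>In units of \<open>\<mu> * R2\<close>: strong convexity puts \<open>F y\<close> at most
  1/2 above \<open>F xs\<close>, the penalty puts \<open>F xs\<close> 1/2 above \<open>f xs\<close>,
  and the inexact step adds at most 1/8. The total 9/8 is below 2.\<close>

lemma small_gradient_step:
  assumes y: "y \<in> carrier_vec n" and small: "dF y \<bullet> dF y \<le> \<mu>\<^sup>2 * R2"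
  shows "f (y - h \<cdot>\<^sub>v gF y) \<le> f xs + 2 * \<mu> * R2"
proof -
  note d = dF_carrier[OF y]
  let ?e = "gF y - dF y"
  have xy: "xs - y \<in> carrier_vec n" using xs_carrier y by simp
  have R2: "0 \<le> R2" by (rule scalar_prod_self_nonneg)
  have ee: "?e \<bullet> ?e \<le> \<mu>\<^sup>2 * R2"
  proof -
    have "?e \<bullet> ?e \<le> \<alpha>\<^sup>2 * (4 * (\<mu>\<^sup>2 * R2))"
      using small by (intro order_trans[OF estimate_error[OF y]] mult_left_mono) auto
    also have "\<dots> \<le> (1 / 9)\<^sup>2 * (4 * (\<mu>\<^sup>2 * R2))"
      using a_bound \<alpha>_pos R2 by (intro mult_right_mono power_mono) auto
    also have "\<dots> \<le> \<mu>\<^sup>2 * R2"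
      using mult_nonneg_nonneg[OF zero_le_power2[of \<mu>] R2] by (simp add: power2_eq_square)
    finally show ?thesis .
  qed
  have hmu: "h * \<mu> \<le> 1 / 4"
    using h_le mult_pos_pos[OF h_pos L_pos] unfolding distrib_left by linarith
  have "F (y - h \<cdot>\<^sub>v gF y) \<le> F y + h / 2 * (?e \<bullet> ?e - dF y \<bullet> dF y)"
    by (rule F_descent[OF y])
  also have "\<dots> \<le> F y + h / 2 * (\<mu>\<^sup>2 * R2)"
    using ee h_pos scalar_prod_self_nonneg[of "dF y"] by (intro add_left_mono mult_left_mono) auto
  also have "h / 2 * (\<mu>\<^sup>2 * R2) = (h * \<mu>) * (\<mu> * R2 / 2)"
    by (simp add: power2_eq_square)
  also have "\<dots> \<le> 1 / 4 * (\<mu> * R2 / 2)"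
    using hmu R2 \<mu>_pos by (intro mult_right_mono) auto
  also have "F y \<le> F xs + \<mu> * R2 / 2"
  proof -
    have "F y \<le> F xs + dF y \<bullet> dF y / (2 * \<mu>)"
      using F_strongly_convex[OF xs_carrier y] scalar_prod_young[OF d xy \<mu>_pos] by simp
    also have "dF y \<bullet> dF y / (2 * \<mu>) \<le> \<mu>\<^sup>2 * R2 / (2 * \<mu>)"
      using small \<mu>_pos by (intro divide_right_mono) auto
    finally show ?thesis using \<mu>_pos by (simp add: power2_eq_square)
  qed
  also note F_xs
  finally have "F (y - h \<cdot>\<^sub>v gF y) \<le> f xs + 9 / 8 * (\<mu> * R2)"
    by simp
  moreover note f_le_F[of "y - h \<cdot>\<^sub>v gF y"]
  moreover have "0 \<le> \<mu> * R2" using \<mu>_pos R2 by simp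
  ultimately show ?thesis
    unfolding mult.assoc by linarith
qed

lemma omega: "0 < \<omega>" "\<omega> \<le> 1" "\<mu> / (2 * (L + \<mu>)) / (270 * a) \<le> \<omega>"
  "\<omega> * a\<^sup>2 + \<omega>\<^sup>2 * (1 + a)\<^sup>2 / 2 \<le> \<mu> / 2 * h / 2 * (1 - a\<^sup>2)"
  using re_omega_bounds[of \<mu> "L + \<mu>" a] \<mu>_pos L_pos a_pos a_bound cond_bound by auto

lemma X_Suc: "X (Suc k) = Y k - h \<cdot>\<^sub>v gF (Y k)"
  and U_Suc: "U (Suc k) = (1 - \<omega>) \<cdot>\<^sub>v U k + \<omega> \<cdot>\<^sub>v Y k - (\<omega> / (\<mu> / 2)) \<cdot>\<^sub>v gF (Y k)"
  by (simp_all add: Let_def case_prod_beta mult.commute)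

lemma iterates_carrier: "X k \<in> carrier_vec n \<and> U k \<in> carrier_vec n"
proof (induction k)
  case 0
  then show ?case using x0_carrier by simp
next
  case (Suc k)
  then have "Y k \<in> carrier_vec n" by simp
  with Suc show ?case
    unfolding X_Suc U_Suc by (simp add: gF_carrier)
qed

lemma Y_carrier: "Y k \<in> carrier_vec n"
  using iterates_carrier by simp

text \<open>The weight is \<open>p / 2\<close> with \<open>p = \<mu> / 2\<close>, as in
  \<open>lyapunov_step\<close>. Since \<open>xs\<close> need not minimize \<open>F\<close>, the
  value can be negative; the later estimates multiply it only by the nonnegative factor
  \<open>1 - \<omega>\<close> and its powers.\<close>

definition \<Phi> :: "nat \<Rightarrow> real" where
  "\<Phi> k = F (X k) - F xs + \<mu> / 2 / 2 * ((U k - xs) \<bullet> (U k - xs))"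

lemma potential_step:
  assumes "\<mu>\<^sup>2 * R2 \<le> dF (Y k) \<bullet> dF (Y k)"
  shows "\<Phi> (Suc k) \<le> (1 - \<omega>) * \<Phi> k"
  unfolding \<Phi>_def
proof (rule lyapunov_step[where y = "Y k" and g = "gF (Y k)" and d = "dF (Y k)" and a = a and h = h])
  show "X k \<in> carrier_vec n" "U k \<in> carrier_vec n" using iterates_carrier by auto
  show "xs \<in> carrier_vec n" by (rule xs_carrier)
  show "gF (Y k) \<in> carrier_vec n" "dF (Y k) \<in> carrier_vec n"
    using Y_carrier by (auto intro: gF_carrier dF_carrier)
  show "Y k = Y k" ..
  show "U (Suc k) = (1 - \<omega>) \<cdot>\<^sub>v U k + \<omega> \<cdot>\<^sub>v Y k - (\<omega> / (\<mu> / 2)) \<cdot>\<^sub>v gF (Y k)"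
    by (rule U_Suc)
  show "F (Y k) + dF (Y k) \<bullet> (xs - Y k) + \<mu> / 2 * ((xs - Y k) \<bullet> (xs - Y k)) \<le> F xs"
    by (rule F_strongly_convex[OF xs_carrier Y_carrier])
  show "F (Y k) + dF (Y k) \<bullet> (X k - Y k) \<le> F (X k)"
  proof -
    have "0 \<le> \<mu> / 2 * ((X k - Y k) \<bullet> (X k - Y k))"
      using \<mu>_pos scalar_prod_self_nonneg[of "X k - Y k"] by simp
    then show ?thesis
      using F_strongly_convex[of "X k" "Y k"] iterates_carrier[of k] Y_carrier[of k] by linarith
  qed
  show err: "(gF (Y k) - dF (Y k)) \<bullet> (gF (Y k) - dF (Y k)) \<le> a\<^sup>2 * (dF (Y k) \<bullet> dF (Y k))"
    by (rule large_gradient_error[OF Y_carrier assms])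
  have "h / 2 * ((gF (Y k) - dF (Y k)) \<bullet> (gF (Y k) - dF (Y k)) - dF (Y k) \<bullet> dF (Y k))
      \<le> h / 2 * (a\<^sup>2 * (dF (Y k) \<bullet> dF (Y k)) - dF (Y k) \<bullet> dF (Y k))"
    using err h_pos by (intro mult_left_mono) auto
  then show "F (X (Suc k)) \<le> F (Y k) - h / 2 * (1 - a\<^sup>2) * (dF (Y k) \<bullet> dF (Y k))"
    unfolding X_Suc using F_descent[OF Y_carrier[of k]]
    by (simp only: right_diff_distrib left_diff_distrib mult_1_right mult.assoc)
qed (use omega \<mu>_pos a_pos in auto)

lemma potential_decay:
  assumes "\<And>k. k < N \<Longrightarrow> \<mu>\<^sup>2 * R2 \<le> dF (Y k) \<bullet> dF (Y k)"
  shows "\<Phi> N \<le> (1 - \<omega>) ^ N * \<Phi> 0"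
  using assms
proof (induction N)
  case (Suc N)
  have "\<Phi> (Suc N) \<le> (1 - \<omega>) * \<Phi> N"
    using Suc.prems by (intro potential_step) simp
  also have "\<dots> \<le> (1 - \<omega>) * ((1 - \<omega>) ^ N * \<Phi> 0)"
    using omega Suc by (intro mult_left_mono) auto
  finally show ?case by simp
qed simp

text \<open>The penalty vanishes at \<open>x0\<close>, and the \<open>\<mu> / 2 * R2\<close>
  contained in \<open>F xs\<close> outweighs the distance term. What remains is
  \<open>f x0 - f xs\<close>, bounded by smoothness at \<open>xs\<close>.\<close>

lemma potential_0: "\<Phi> 0 \<le> L * R2"
proof -
  let ?r = "x0 - xs"
  have r: "?r \<in> carrier_vec n" using x0_carrier xs_carrier by simp
  note Gs = G_carrier[OF xs_carrier]
  have sm: "f x \<le> f xs + G xs \<bullet> (x - xs) + L / 2 * ((x - xs) \<bullet> (x - xs))"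
    if x: "x \<in> carrier_vec n" for x
    using F_smooth[OF x xs_carrier]
      reg_fun_expand[where G = G and f = f and \<mu> = \<mu>, OF x xs_carrier x0_carrier Gs]
    by (simp add: add_divide_distrib distrib_right)
  \<comment> \<open>An exact gradient step from the minimizer cannot decrease \<open>f\<close>, so
    the gradient there vanishes.\<close>
  have "f (xs - (1 / L) \<cdot>\<^sub>v G xs)
      \<le> f xs + (1 / L) / 2 * ((G xs - G xs) \<bullet> (G xs - G xs) - G xs \<bullet> G xs)"
    using sm L_pos by (intro gradient_step_descent[OF xs_carrier Gs Gs]) auto
  also have "(G xs - G xs) \<bullet> (G xs - G xs) = 0"
    using Gs by simp
  finally have "f xs \<le> f xs - G xs \<bullet> G xs / (2 * L)"
    using xs_min[of "xs - (1 / L) \<cdot>\<^sub>v G xs"] xs_carrier Gs by simp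
  then have GG: "G xs \<bullet> G xs \<le> 0"
    using L_pos by (simp add: field_simps)
  have "G xs \<bullet> G xs / (2 * L) \<le> 0"
    using GG L_pos by (simp add: divide_nonpos_pos)
  moreover have "- (((- 1) \<cdot>\<^sub>v G xs) \<bullet> ?r) \<le>
      ((- 1) \<cdot>\<^sub>v G xs) \<bullet> ((- 1) \<cdot>\<^sub>v G xs) / (2 * L) + L / 2 * R2"
    using Gs by (intro scalar_prod_young[OF _ r L_pos]) simp
  ultimately have "G xs \<bullet> ?r \<le> L / 2 * R2"
    using Gs r by simp
  then have "f x0 - f xs \<le> L * R2"
    using sm[OF x0_carrier] by simp
  moreover have "x0 - x0 = 0\<^sub>v n" using x0_carrier by simp
  moreover note F_xs
  moreover have "0 \<le> \<mu> * R2"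
    using \<mu>_pos scalar_prod_self_nonneg[of ?r] by simp
  ultimately show ?thesis
    using x0_carrier
    unfolding \<Phi>_def by (simp add: reg_fun_def[of _ _ _ x0])
qed

lemma f_le_potential: "f (X k) - f xs \<le> \<Phi> k + \<mu> / 2 * R2"
proof -
  note F_xs f_le_F[of "X k"]
  moreover have "0 \<le> \<mu> / 2 / 2 * ((U k - xs) \<bullet> (U k - xs))"
    using \<mu>_pos scalar_prod_self_nonneg[of "U k - xs"] by simp
  ultimately show ?thesis unfolding \<Phi>_def by linarith
qed

text \<open>The first disjunct covers a small gradient at some step before \<open>N\<close>. The
  precision is then known for the next iterate only, not for those after it.\<close>

lemma accuracy:
  "(\<exists>k\<le>N. f (X k) - f xs \<le> 2 * \<mu> * R2) \<or>
   f (X N) - f xs \<le> (1 - \<omega>) ^ N * (L * R2) + \<mu> / 2 * R2"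
proof (cases "\<exists>k<N. dF (Y k) \<bullet> dF (Y k) \<le> \<mu>\<^sup>2 * R2")
  case True
  then obtain k where "k < N" "dF (Y k) \<bullet> dF (Y k) \<le> \<mu>\<^sup>2 * R2" by auto
  then have "Suc k \<le> N \<and> f (X (Suc k)) - f xs \<le> 2 * \<mu> * R2"
    unfolding X_Suc using small_gradient_step[OF Y_carrier[of k]] by simp
  then show ?thesis by blast
next
  case False
  then have "\<Phi> N \<le> (1 - \<omega>) ^ N * \<Phi> 0"
    by (intro potential_decay) force
  also have "\<dots> \<le> (1 - \<omega>) ^ N * (L * R2)"
    using potential_0 omega by (intro mult_left_mono) auto
  finally show ?thesis
    using f_le_potential[of N] by simp
qed

end

section \<open>Choice of the parameters and iteration count\<close>

theorem theorem9p3: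
  fixes L R \<alpha> \<tau> \<epsilon> :: real
  assumes "0 < \<epsilon>" and "\<epsilon> \<le> L * R\<^sup>2"
    and "0 \<le> \<tau>" and "\<tau> \<le> 1 / 2"
    and "0 < \<alpha>" and "\<alpha> \<le> 1 / 9 * (\<epsilon> / (2 * L * R\<^sup>2)) powr \<tau>"
  shows "\<exists>\<mu> L' \<mu>' a :: real.
    0 < \<mu> \<and> 0 < \<mu>' \<and> \<mu>' \<le> L' \<and> 0 \<le> a \<and> a \<le> 1 / 3 \<and>
    (\<forall>(n::nat) (f :: real vec \<Rightarrow> real) (G :: real vec \<Rightarrow> real vec)
      (g :: real vec \<Rightarrow> real vec) (x0 :: real vec) (xs :: real vec).
       has_gradient n f G \<and> convex_diff n f G \<and> L_smooth n L f G \<and>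
       minimizer n f xs \<and> x0 \<in> carrier_vec n \<and> R = vnorm (x0 - xs) \<and>
       relative_error n \<alpha> G g
       \<longrightarrow> (\<exists>N::nat.
             f (fst (re_agm L' \<mu>' x0 a (reg_grad \<mu> x0 g) N)) - f xs \<le> \<epsilon> \<and>
             real N \<le> 72000 * (L * R\<^sup>2 / \<epsilon>) powr (1 - \<tau>) * ln (480 * L * R\<^sup>2 / \<epsilon>)))"
proof -
  define \<Lambda> where "\<Lambda> = L * R\<^sup>2 / \<epsilon>"
  define \<theta> where "\<theta> = (\<epsilon> / (2 * L * R\<^sup>2)) powr \<tau>"
  \<comment> \<open>This makes \<open>2 * \<mu> * R\<^sup>2\<close>, the precision in the small
    gradient case, equal to \<open>\<epsilon>\<close>.\<close>
  define \<mu> where "\<mu> = \<epsilon> / (2 * R\<^sup>2)"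
  define a where "a = \<theta> / 3"
  define P where "P = \<Lambda> powr (1 - \<tau>)"
  \<comment> \<open>Enough steps to bring \<open>(1 - \<omega>) ^ N\<close> below 1/(2 \<Lambda>),
    hence the potential below \<epsilon>/2.\<close>
  define N where "N = nat \<lceil>540 * P * ln (2 * \<Lambda>)\<rceil>"
  have LR: "0 < L * R\<^sup>2" using assms by linarith
  then have R0: "0 < R\<^sup>2" and L0: "0 < L"
    by (auto simp: zero_less_mult_iff not_less[symmetric])
  have \<Lambda>1: "1 \<le> \<Lambda>" using assms by (simp add: \<Lambda>_def)
  have \<theta>eq: "\<theta> = (1 / (2 * \<Lambda>)) powr \<tau>"
    by (simp add: \<theta>_def \<Lambda>_def mult.assoc)
  have \<theta>0: "0 < \<theta>" and \<theta>1: "\<theta> \<le> 1"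
    using \<Lambda>1 assms by (auto simp: \<theta>eq intro: powr_le1)
  have \<mu>0: "0 < \<mu>" using assms R0 by (simp add: \<mu>_def)
  have \<mu>R: "\<mu> * R\<^sup>2 = \<epsilon> / 2" using R0 by (simp add: \<mu>_def)
  have \<mu>L: "\<mu> / L = 1 / (2 * \<Lambda>)"
    by (simp add: \<mu>_def \<Lambda>_def mult_ac)
  then have \<mu>_le: "\<mu> \<le> L / 2"
    using \<Lambda>1 L0 \<mu>0 by (simp add: field_simps)
  have a0: "0 < a" "a \<le> 1 / 3" "3 * \<alpha> \<le> a"
    using \<theta>0 \<theta>1 assms(6) by (auto simp: a_def \<theta>_def)
  \<comment> \<open>Here \<open>\<tau> \<le> 1 / 2\<close> enters: the base 1/(2 \<Lambda>) is at
    most 1, so its first power is at most its power 2 \<tau>, which is the square of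
    \<theta>.\<close>
  have cond: "\<mu> / (2 * (L + \<mu>)) \<le> (3 * a)\<^sup>2"
  proof -
    have "\<mu> / (2 * (L + \<mu>)) \<le> \<mu> / L"
      using \<mu>0 L0 by (intro divide_left_mono) auto
    also have "\<dots> = (1 / (2 * \<Lambda>)) powr 1" using \<mu>L \<Lambda>1 by simp
    also have "\<dots> \<le> (1 / (2 * \<Lambda>)) powr (\<tau> + \<tau>)"
      using \<Lambda>1 assms by (intro powr_mono') auto
    also have "\<dots> = (3 * a)\<^sup>2"
      unfolding powr_add by (simp add: a_def \<theta>eq power2_eq_square)
    finally show ?thesis .
  qed
  have P1: "1 \<le> P" using \<Lambda>1 assms by (simp add: P_def ge_one_powr_ge_zero)
  \<comment> \<open>As \<open>\<mu> \<le> L / 2\<close>, the denominator 2(L + \<mu>) is at most 3L.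
    With \<mu>/L = 1/(2 \<Lambda>) and a = \<theta>/3 this gives 1/(540 \<theta> \<Lambda>), and
    \<theta> \<Lambda> is at most \<open>P\<close>.\<close>
  have rate: "1 / (540 * P) \<le> \<mu> / (2 * (L + \<mu>)) / (270 * a)"
  proof -
    have "\<theta> \<le> (1 / \<Lambda>) powr \<tau>"
      unfolding \<theta>eq using \<Lambda>1 assms by (intro powr_mono2) (auto simp: field_simps)
    also have "\<dots> = P / \<Lambda>"
      using \<Lambda>1 by (simp add: P_def powr_diff powr_divide)
    finally have "\<theta> * \<Lambda> \<le> P" using \<Lambda>1 by (simp add: field_simps)
    then have "1 / (540 * P) \<le> 1 / (540 * (\<theta> * \<Lambda>))"
      using \<theta>0 \<Lambda>1 by (intro frac_le) auto
    also have "\<dots> = \<mu> / (3 * L) / (270 * a)"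
      using \<mu>L L0 \<mu>0 \<Lambda>1 \<theta>0 by (simp add: a_def field_simps)
    also have "\<dots> \<le> \<mu> / (2 * (L + \<mu>)) / (270 * a)"
      using \<mu>0 L0 a0 \<mu>_le by (intro divide_right_mono divide_left_mono) auto
    finally show ?thesis .
  qed
  have N_ge: "540 * P * ln (2 * \<Lambda>) \<le> real N"
    unfolding N_def by (rule real_nat_ceiling_ge)
  \<comment> \<open>Rounding up costs at most 1, which is absorbed by
    \<open>P * ln (480 * \<Lambda>)\<close>; the constant 541 would suffice.\<close>
  have N_le: "real N \<le> 72000 * P * ln (480 * \<Lambda>)"
  proof -
    have "exp 1 \<le> 480 * \<Lambda>" using \<Lambda>1 exp_le by linarith
    then have l1: "1 \<le> ln (480 * \<Lambda>)" using \<Lambda>1 by (simp add: ln_ge_iff)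
    have "ln (2 * \<Lambda>) \<le> ln (480 * \<Lambda>)" using \<Lambda>1 by simp
    then have "540 * P * ln (2 * \<Lambda>) \<le> 540 * P * ln (480 * \<Lambda>)"
      using P1 by (intro mult_left_mono) auto
    moreover have "1 * 1 \<le> P * ln (480 * \<Lambda>)" using P1 l1 by (intro mult_mono) auto
    moreover have "0 \<le> 540 * P * ln (2 * \<Lambda>)" using P1 \<Lambda>1 by simp
    then have "real N \<le> 540 * P * ln (2 * \<Lambda>) + 1"
      unfolding N_def by (simp add: of_nat_ceiling)
    ultimately show ?thesis by simp
  qed
  have main: "\<exists>M. f (fst (re_agm (L + \<mu>) \<mu> x0 a (reg_grad \<mu> x0 g) M)) - f xs \<le> \<epsilon> \<and>
      real M \<le> 72000 * (L * R\<^sup>2 / \<epsilon>) powr (1 - \<tau>) * ln (480 * L * R\<^sup>2 / \<epsilon>)"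
    if hyp: "has_gradient n f G" "convex_diff n f G" "L_smooth n L f G"
       "minimizer n f xs" "x0 \<in> carrier_vec n" "R = vnorm (x0 - xs)"
       "relative_error n \<alpha> G g" for n f G g x0 xs
  proof -
    interpret regularized_problem n f G g x0 xs L \<mu> \<alpha> a
      using hyp L0 \<mu>0 assms(5) a0 cond by unfold_locales (auto simp: has_gradient_def)
    have R2: "(x0 - xs) \<bullet> (x0 - xs) = R\<^sup>2"
      using hyp by (simp add: vnorm_power2)
    have "ln (2 * \<Lambda>) \<le> \<omega> * real N"
    proof -
      have "ln (2 * \<Lambda>) = 1 / (540 * P) * (540 * P * ln (2 * \<Lambda>))" using P1 by simp
      also have "\<dots> \<le> \<omega> * real N"
        using rate omega N_ge P1 \<Lambda>1 by (intro mult_mono) auto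
      finally show ?thesis .
    qed
    have "(1 - \<omega>) ^ N \<le> exp (- \<omega>) ^ N"
      using omega exp_ge_add_one_self[of "- \<omega>"] by (intro power_mono) auto
    also have "\<dots> = exp (- (\<omega> * real N))"
      by (simp add: exp_of_nat_mult[symmetric] mult.commute)
    also have "\<dots> \<le> exp (- ln (2 * \<Lambda>))"
      using \<open>ln (2 * \<Lambda>) \<le> \<omega> * real N\<close> by simp
    also have "\<dots> = 1 / (2 * \<Lambda>)"
      using \<Lambda>1 by (simp add: exp_minus inverse_eq_divide)
    finally have "(1 - \<omega>) ^ N * (L * R\<^sup>2) \<le> 1 / (2 * \<Lambda>) * (L * R\<^sup>2)"
      using LR by (intro mult_right_mono) auto
    also have "\<dots> = \<epsilon> / 2" using R0 L0 assms(1) by (simp add: \<Lambda>_def)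
    finally have "(1 - \<omega>) ^ N * (L * R\<^sup>2) + \<mu> / 2 * R\<^sup>2 \<le> \<epsilon>"
      using \<mu>R assms by simp
    moreover have "2 * \<mu> * R\<^sup>2 = \<epsilon>" using \<mu>R by simp
    ultimately obtain M where "M \<le> N" "f (X M) - f xs \<le> \<epsilon>"
      using accuracy[of N] unfolding R2 by force
    then show ?thesis
      using N_le by (intro exI[of _ M]) (simp add: P_def \<Lambda>_def mult.assoc)
  qed
  show ?thesis
    using \<mu>0 L0 a0 main
    by (intro exI[of _ \<mu>] exI[of _ "L + \<mu>"] exI[of _ \<mu>] exI[of _ a]) auto
qed

end
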